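(* For a contraction $C\in M_n(\mathbb{C})$ with $D=I-C^*C$, the following are equivalent: (i) every level of the partial isometry tower of $C$ has the Circularity property; (ii) for every $1\le k\le n$, every $0\le m\le k$, and every integer $\ell$ with $0\le\ell\le k-m$ and $2\ell\ne k-m$, one has $\Omega_{k,m,\ell}(C)=0$.
   Context: For integers $k\ge1$, $0\le m\le k$, $0\le\ell\le k-m$, let $\mathcal{W}_{k,m,\ell}$ be the set of all words of length $k$ in the three noncommuting letters $C, C^*, D$ (where $D=I-C^*C$) with exactly $m$ letters $D$ and exactly $\ell$ letters $C^*$ (hence $k-m-\ell$ letters $C$), and $\Omega_{k,m,\ell}(C):=\sum_{w\in\mathcal{W}_{k,m,\ell}}\operatorname{tr} w(C,C^*,D)$. For $X\in M_n(\mathbb{C})$, $H_X(\theta)=\frac12(e^{-i\theta}X+e^{i\theta}X^* )$ and $X$ has the Circularity property if the spectrum of $H_X(\theta)$ is independent of $\theta$. A contraction is a matrix with $\|C\|\le1$. For a contraction $C$: $D_C=I-C^*C$, $d=\operatorname{rank}D_C$, $B_C$ is a $d\times n$ matrix of full row rank with $B_C^*B_C=D_C$, $\mathcal{A}(C)=\begin{bmatrix}0&B_C\\0&C\end{bmatrix}$, tower $T_0=C$, $T_{j+1}=\mathcal{A}(T_j)$. *)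

theory Defs
  imports "Jordan_Normal_Form.Spectral_Radius" "Jordan_Normal_Form.Schur_Decomposition"
          "Jordan_Normal_Form.DL_Rank"
begin

definition vnorm2 :: "complex vec \<Rightarrow> real" where
  "vnorm2 v = (\<Sum>i<dim_vec v. (cmod (v $ i))^2)"

definition contraction :: "complex mat \<Rightarrow> bool" where
  "contraction C \<longleftrightarrow> (\<forall>v \<in> carrier_vec (dim_col C). vnorm2 (C *\<^sub>v v) \<le> vnorm2 v)"

definition mtrace :: "complex mat \<Rightarrow> complex" where
  "mtrace A = (\<Sum>i<dim_row A. A $$ (i,i))"

definition defect :: "complex mat \<Rightarrow> complex mat" where
  "defect C = 1\<^sub>m (dim_col C) - mat_adjoint C * C"

definition defect_rank :: "complex mat \<Rightarrow> nat" where
  "defect_rank C = vec_space.rank (dim_col C) (defect C)"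

definition Bmat :: "complex mat \<Rightarrow> complex mat" where
  "Bmat C = (SOME B. B \<in> carrier_mat (defect_rank C) (dim_col C)
                  \<and> vec_space.rank (dim_row B) B = defect_rank C
                  \<and> mat_adjoint B * B = defect C)"

definition Amap :: "complex mat \<Rightarrow> complex mat" where
  "Amap C = four_block_mat (0\<^sub>m (defect_rank C) (defect_rank C)) (Bmat C)
                           (0\<^sub>m (dim_row C) (defect_rank C)) C"

primrec tower :: "complex mat \<Rightarrow> nat \<Rightarrow> complex mat" where
  "tower C 0 = C"
| "tower C (Suc j) = Amap (tower C j)"

definition Hmat :: "complex mat \<Rightarrow> real \<Rightarrow> complex mat" where
  "Hmat X \<theta> = (1/2 :: complex) \<cdot>\<^sub>m
     (exp (- \<i> * of_real \<theta>) \<cdot>\<^sub>m X + exp (\<i> * of_real \<theta>) \<cdot>\<^sub>m mat_adjoint X)"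

definition circularity :: "complex mat \<Rightarrow> bool" where
  "circularity X \<longleftrightarrow> (\<forall>\<theta> \<theta>'. spectrum (Hmat X \<theta>) = spectrum (Hmat X \<theta>'))"

datatype letter = LetC | LetCs | LetD

definition letter_mat :: "complex mat \<Rightarrow> letter \<Rightarrow> complex mat" where
  "letter_mat C a = (case a of LetC \<Rightarrow> C | LetCs \<Rightarrow> mat_adjoint C | LetD \<Rightarrow> defect C)"

definition word_eval :: "complex mat \<Rightarrow> letter list \<Rightarrow> complex mat" where
  "word_eval C w = foldr (\<lambda>a M. letter_mat C a * M) w (1\<^sub>m (dim_col C))"

definition words :: "nat \<Rightarrow> nat \<Rightarrow> nat \<Rightarrow> letter list set" where
  "words k m l = {w. length w = k \<and> count_list w LetD = m \<and> count_list w LetCs = l}"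

definition Omega :: "nat \<Rightarrow> nat \<Rightarrow> nat \<Rightarrow> complex mat \<Rightarrow> complex" where
  "Omega k m l C = (\<Sum>w \<in> words k m l. mtrace (word_eval C w))"

end

theory Submission
  imports Defs "HOL-Computational_Algebra.Polynomial_FPS"
begin

text \<open>Write \<open>G\<^sub>X(z,t,\<theta>) = det (z - H\<^sub>X(\<theta>) - t D\<^sub>X)\<close>. Since the defect of \<open>A(X)\<close> is the projection onto the new
coordinates, a Schur complement gives \<open>G\<close> of \<open>A(X)\<close> at \<open>(z,t)\<close> as \<open>(z-t)^d\<close> times \<open>G\<close> of \<open>X\<close> at
\<open>(z, 1/(4(z-t)))\<close>. Hence level \<open>j\<close> of the tower has the Circularity property iff \<open>G\<^sub>C(z,t,\<theta>)\<close> does not depend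
on \<open>\<theta>\<close> on the curve \<open>t = \<rho>\<^sub>j(z)\<close>, where \<open>\<rho>\<^sub>j(z)\<close> is the \<open>j\<close>-th iterate of \<open>t \<mapsto> 1/(4(z-t))\<close> at 0. For fixed \<open>z > 1\<close>
these iterates are pairwise distinct and \<open>G\<^sub>C\<close> is a polynomial in \<open>t\<close>, so all levels together say that
the characteristic polynomial of \<open>H\<^sub>C(\<theta>) + t D\<close> is independent of \<open>\<theta>\<close> for every \<open>t\<close>. By Newton's identities
this concerns only the traces of its powers up to \<open>n\<close>, and the numbers \<open>\<Omega>\<close> are, up to powers of 2, the
coefficients of these traces as polynomials in \<open>t\<close> and \<open>e^{i\<theta>}\<close>.\<close>

subsection \<open>Power sums and characteristic polynomials\<close>

text \<open>Newton's identities as a logarithmic derivative: each factor contributes -a/(1 - aX),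
  whose coefficient at X^k is -a^(k+1).\<close>

lemma fps_deriv_prod_list_linear:
  fixes as :: "'a :: field_char_0 list"
  shows "fps_deriv (\<Prod>a\<leftarrow>as. 1 - fps_const a * fps_X) =
    - ((\<Prod>a\<leftarrow>as. 1 - fps_const a * fps_X) * Abs_fps (\<lambda>k. \<Sum>a\<leftarrow>as. a ^ Suc k))"
proof (induction as)
  case Nil
  have "Abs_fps (\<lambda>k. 0::'a) = 0" by (simp add: fps_eq_iff)
  then show ?case by simp
next
  case (Cons a as)
  let ?Q = "\<Prod>a\<leftarrow>as. 1 - fps_const a * fps_X"
  let ?S = "Abs_fps (\<lambda>k. \<Sum>a\<leftarrow>as. a ^ Suc k)"
  let ?G = "Abs_fps (\<lambda>k. a ^ Suc k)"
  have G: "(1 - fps_const a * fps_X) * ?G = fps_const a"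
  proof (rule fps_ext)
    fix n show "fps_nth ((1 - fps_const a * fps_X) * ?G) n = fps_nth (fps_const a) n"
      by (cases n) (simp_all add: algebra_simps)
  qed
  have S: "Abs_fps (\<lambda>k. \<Sum>a\<leftarrow>a#as. a ^ Suc k) = ?G + ?S"
    by (simp add: fps_eq_iff)
  have "fps_deriv (1 - fps_const a * fps_X) = - fps_const a" by simp
  then have "fps_deriv (\<Prod>a\<leftarrow>a#as. 1 - fps_const a * fps_X) =
      - (fps_const a * ?Q) - (1 - fps_const a * fps_X) * ?Q * ?S"
    unfolding list.map prod_list.Cons fps_deriv_mult Cons.IH
    by (simp del: fps_const_neg add: fps_const_neg[symmetric])
  also have "\<dots> = - ((1 - fps_const a * fps_X) * ?G * ?Q) - (1 - fps_const a * fps_X) * ?Q * ?S"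
    unfolding G by simp
  also have "\<dots> = - ((\<Prod>a\<leftarrow>a#as. 1 - fps_const a * fps_X) * (?G + ?S))"
    by (simp add: algebra_simps)
  finally show ?case unfolding S .
qed

text \<open>Reversing the coefficients turns each factor X - a into 1 - aX, the form in which the
  logarithmic derivative generates power sums.\<close>

lemma fps_of_reflect_prod_list_linear:
  fixes as :: "'a :: field_char_0 list"
  shows "fps_of_poly (reflect_poly (\<Prod>a\<leftarrow>as. [:- a, 1:])) = (\<Prod>a\<leftarrow>as. 1 - fps_const a * fps_X)"
proof -
  have "reflect_poly [:- a, 1:] = [:1, - a:]" for a :: 'a
    by (rule poly_eqI) (auto simp: coeff_reflect_poly coeff_pCons split: nat.splits)
  then show ?thesis
    by (induction as) (simp_all add: reflect_poly_mult fps_of_poly_mult fps_of_poly_pCons del: mult_pCons_left)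
qed

text \<open>Newton's identities are a recursion: coefficient k + 1 times k + 1 is determined by the
  earlier coefficients and the power sums up to k + 1. In characteristic zero the factor k + 1 can
  be cancelled.\<close>

lemma power_sums_determine_poly:
  fixes as bs :: "'a :: field_char_0 list"
  assumes len: "length as = n" "length bs = n"
    and ps: "\<And>k. 1 \<le> k \<Longrightarrow> k \<le> n \<Longrightarrow> (\<Sum>a\<leftarrow>as. a ^ k) = (\<Sum>b\<leftarrow>bs. b ^ k)"
  shows "(\<Prod>a\<leftarrow>as. [:- a, 1:]) = (\<Prod>b\<leftarrow>bs. [:- b, 1:])"
proof -
  define F where "F = (\<lambda>cs :: 'a list. \<Prod>c\<leftarrow>cs. 1 - fps_const c * fps_X)"
  have newton: "of_nat (Suc k) * fps_nth (F cs) (Suc k) =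
      - (\<Sum>i=0..k. fps_nth (F cs) i * (\<Sum>c\<leftarrow>cs. c ^ Suc (k - i)))" for cs k
  proof -
    have "of_nat (Suc k) * fps_nth (F cs) (Suc k) = fps_nth (fps_deriv (F cs)) k"
      by simp
    also have "\<dots> = - (\<Sum>i=0..k. fps_nth (F cs) i * (\<Sum>c\<leftarrow>cs. c ^ Suc (k - i)))"
      unfolding F_def fps_deriv_prod_list_linear by (simp add: fps_mult_nth)
    finally show ?thesis .
  qed
  have F0: "fps_nth (F cs) 0 = 1" for cs
    unfolding F_def by (induction cs) simp_all
  have eq: "k \<le> n \<Longrightarrow> fps_nth (F as) k = fps_nth (F bs) k" for k
  proof (induction k rule: less_induct)
    case (less k)
    show ?case
    proof (cases k)
      case 0
      then show ?thesis by (simp add: F0)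
    next
      case (Suc m)
      have "(\<Sum>i=0..m. fps_nth (F as) i * (\<Sum>c\<leftarrow>as. c ^ Suc (m - i))) =
            (\<Sum>i=0..m. fps_nth (F bs) i * (\<Sum>c\<leftarrow>bs. c ^ Suc (m - i)))"
        using less Suc by (intro sum.cong refl arg_cong2[where f = "(*)"] ps) auto
      then have "of_nat (Suc m) * fps_nth (F as) (Suc m) = of_nat (Suc m) * fps_nth (F bs) (Suc m)"
        unfolding newton by simp
      \<comment> \<open>Keeping \<open>of_nat (Suc m)\<close> folded lets the simplifier see that
        the common factor is nonzero.\<close>
      then show ?thesis unfolding Suc by (simp del: of_nat_Suc)
    qed
  qed
  let ?p = "\<lambda>cs :: 'a list. \<Prod>c\<leftarrow>cs. [:- c, 1:]"
  have deg: "degree (?p cs) = length cs" for cs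
    by (rule degree_linear_factors)
  \<comment> \<open>Reversal about position n is correct because a product of n monic linear factors
    has degree exactly n.\<close>
  have coeff: "coeff (?p cs) i = fps_nth (F cs) (n - i)" if "length cs = n" "i \<le> n" for cs i
  proof -
    have "fps_nth (F cs) (n - i) = coeff (reflect_poly (?p cs)) (n - i)"
      unfolding F_def fps_of_reflect_prod_list_linear[symmetric] by simp
    then show ?thesis using that deg[of cs] by (simp add: coeff_reflect_poly)
  qed
  show ?thesis
  proof (rule poly_eqI)
    fix i
    show "coeff (?p as) i = coeff (?p bs) i"
    proof (cases "i \<le> n")
      case True
      then show ?thesis using coeff len eq by simp
    next
      case False
      then show ?thesis using deg len by (simp add: coeff_eq_0)
    qed
  qed
qed

section \<open>Traces of powers in terms of eigenvalues\<close>

lemma mtrace_mult_comm: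
  assumes "A \<in> carrier_mat n m" "B \<in> carrier_mat m n"
  shows "mtrace (A * B) = mtrace (B * A)"
proof -
  have "mtrace (A * B) = (\<Sum>i<n. \<Sum>j<m. A $$ (i,j) * B $$ (j,i))"
    using assms by (simp add: mtrace_def scalar_prod_def atLeast0LessThan)
  also have "\<dots> = (\<Sum>j<m. \<Sum>i<n. A $$ (i,j) * B $$ (j,i))"
    by (rule sum.swap)
  also have "\<dots> = mtrace (B * A)"
    using assms by (simp add: mtrace_def scalar_prod_def atLeast0LessThan mult.commute)
  finally show ?thesis .
qed

text \<open>In the sum for entry (i,j) of \<open>?P * B\<close>, the term l vanishes if l < i or j <
  l. For j < i this covers every l; for j = i only l = i survives.\<close>

lemma upper_triangular_pow:
  fixes B :: "'a :: semiring_1 mat"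
  assumes B: "B \<in> carrier_mat n n" and ut: "upper_triangular B"
  shows "upper_triangular (B ^\<^sub>m k) \<and> (\<forall>i<n. (B ^\<^sub>m k) $$ (i,i) = B $$ (i,i) ^ k)"
proof (induction k)
  case 0
  then show ?case using B by auto
next
  case (Suc k)
  let ?P = "B ^\<^sub>m k"
  have P: "?P \<in> carrier_mat n n" using B by simp
  have entry: "(?P * B) $$ (i,j) = (\<Sum>l<n. ?P $$ (i,l) * B $$ (l,j))" if "i < n" "j < n" for i j
    using that P B by (simp add: scalar_prod_def atLeast0LessThan)
  have P0: "?P $$ (i,l) = 0" if "l < i" "i < n" for i l
    using Suc that P by (auto simp: upper_triangular_def)
  have B0: "B $$ (i,l) = 0" if "l < i" "i < n" for i l
    using ut that B by (auto simp: upper_triangular_def)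
  have "(?P * B) $$ (i,j) = 0" if "j < i" "i < n" for i j
    unfolding entry[OF that(2) less_trans[OF that]]
    using that P0 B0 by (intro sum.neutral ballI) (metis lessThan_iff linorder_neqE_nat mult_zero_left mult_zero_right order_less_trans)
  moreover have "(?P * B) $$ (i,i) = B $$ (i,i) ^ Suc k" if i: "i < n" for i
  proof -
    have "(?P * B) $$ (i,i) = (\<Sum>l<n. if l = i then ?P $$ (i,i) * B $$ (i,i) else 0)"
      unfolding entry[OF i i] using P0 B0 i
      by (intro sum.cong refl) (metis lessThan_iff linorder_neqE_nat mult_zero_left mult_zero_right)
    then show ?thesis using i Suc by (simp add: power_commutes)
  qed
  ultimately show ?case using P B by auto
qed

text \<open>The Schur form has exactly the list \<open>as\<close> on its diagonal, and the trace is
  invariant under similarity.\<close>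

lemma mtrace_pow_eq_power_sum:
  assumes A: "A \<in> carrier_mat n n" and c: "char_poly A = (\<Prod>a\<leftarrow>as. [:- a, 1:])"
  shows "mtrace (A ^\<^sub>m k) = (\<Sum>a\<leftarrow>as. a ^ k)"
proof -
  obtain B P Q where s: "schur_decomposition A as = (B,P,Q)"
    by (cases "schur_decomposition A as") auto
  from schur_decomposition[OF A c s] have wit: "similar_mat_wit A B P Q"
    and ut: "upper_triangular B" and diag: "diag_mat B = as" by auto
  note D = similar_mat_witD2[OF A wit]
  have pow: "A ^\<^sub>m k = P * B ^\<^sub>m k * Q" by (rule similar_mat_wit_pow_id[OF wit])
  have "mtrace (A ^\<^sub>m k) = mtrace (Q * (P * B ^\<^sub>m k))"
    unfolding pow using D by (intro mtrace_mult_comm[of _ n n]) auto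
  also have "Q * (P * B ^\<^sub>m k) = (Q * P) * B ^\<^sub>m k"
    using D by (intro assoc_mult_mat[symmetric, of _ n n _ n _ n]) auto
  also have "\<dots> = B ^\<^sub>m k" using D by simp
  also have "mtrace (B ^\<^sub>m k) = (\<Sum>i<n. B $$ (i,i) ^ k)"
    using upper_triangular_pow[OF D(5) ut] D(5) by (simp add: mtrace_def)
  also have "\<dots> = (\<Sum>a\<leftarrow>diag_mat B. a ^ k)"
    using D(5) by (simp add: diag_mat_def sum_list_sum_nth atLeast0LessThan)
  finally show ?thesis unfolding diag .
qed

lemma char_poly_eq_iff_mtrace_pow_eq:
  assumes A: "A \<in> carrier_mat n n" and B: "B \<in> carrier_mat n n"
  shows "char_poly A = char_poly B \<longleftrightarrow>
    (\<forall>k. 1 \<le> k \<and> k \<le> n \<longrightarrow> mtrace (A ^\<^sub>m k) = mtrace (B ^\<^sub>m k))"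
proof -
  obtain as where as: "char_poly A = (\<Prod>a\<leftarrow>as. [:- a, 1:])" "length as = n"
    using char_poly_factorized[OF A] by auto
  obtain bs where bs: "char_poly B = (\<Prod>a\<leftarrow>bs. [:- a, 1:])" "length bs = n"
    using char_poly_factorized[OF B] by auto
  note tr = mtrace_pow_eq_power_sum[OF A as(1)] mtrace_pow_eq_power_sum[OF B bs(1)]
  show ?thesis
  proof
    assume eq: "char_poly A = char_poly B"
    show "\<forall>k. 1 \<le> k \<and> k \<le> n \<longrightarrow> mtrace (A ^\<^sub>m k) = mtrace (B ^\<^sub>m k)"
      \<comment> \<open>The eigenvalue list of \<open>A\<close> also factors the characteristic
        polynomial of \<open>B\<close>, so both traces are the same power sum.\<close>
      using mtrace_pow_eq_power_sum[OF B as(1)[unfolded eq]] tr(1) by simp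
  next
    assume "\<forall>k. 1 \<le> k \<and> k \<le> n \<longrightarrow> mtrace (A ^\<^sub>m k) = mtrace (B ^\<^sub>m k)"
    then show "char_poly A = char_poly B"
      unfolding as(1) bs(1) tr using power_sums_determine_poly[OF as(2) bs(2)] by simp
  qed
qed

subsection \<open>Traces of powers as sums over words\<close>

lemma adjoint_dim [simp]:
  "dim_row (mat_adjoint A) = dim_col A" "dim_col (mat_adjoint A) = dim_row A"
  by (simp_all add: mat_adjoint_def)

lemma adjoint_carrier [simp]: "A \<in> carrier_mat n m \<Longrightarrow> mat_adjoint A \<in> carrier_mat m n"
  by auto

lemma adjoint_index [simp]:
  assumes "i < dim_col A" "j < dim_row A"
  shows "mat_adjoint A $$ (i,j) = conjugate (A $$ (j,i))"
  using assms unfolding mat_adjoint_def by (simp add: mat_of_rows_def)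

lemma defect_dim [simp]: "dim_row (defect A) = dim_col A" "dim_col (defect A) = dim_col A"
  unfolding defect_def by simp_all

lemma defect_carrier [simp]: "A \<in> carrier_mat m n \<Longrightarrow> defect A \<in> carrier_mat n n"
  unfolding defect_def by auto

lemma letter_mat_carrier [simp]: "C \<in> carrier_mat n n \<Longrightarrow> letter_mat C x \<in> carrier_mat n n"
  unfolding letter_mat_def by (auto split: letter.split)

lemma word_eval_Nil: "word_eval C [] = 1\<^sub>m (dim_col C)"
  and word_eval_Cons: "word_eval C (x # w) = letter_mat C x * word_eval C w"
  unfolding word_eval_def by simp_all

lemma word_eval_carrier [simp]: "C \<in> carrier_mat n n \<Longrightarrow> word_eval C w \<in> carrier_mat n n"
  by (induction w) (auto simp: word_eval_Nil word_eval_Cons intro!: mult_carrier_mat[of _ n n])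

lemma UNIV_letter: "(UNIV :: letter set) = {LetC, LetCs, LetD}"
  using letter.exhaust by auto

lemma finite_letter_lists: "finite {w :: letter list. length w = k}"
proof -
  have "finite (UNIV :: letter set)" unfolding UNIV_letter by simp
  from finite_lists_length_eq[OF this] show ?thesis by simp
qed

lemma sum_lists_length_Suc:
  "(\<Sum>w | length w = Suc k. f w) = (\<Sum>x\<in>(UNIV :: letter set). \<Sum>w | length w = k. f (x # w))"
proof -
  have "{w :: letter list. length w = Suc k} = (\<lambda>(x, w). x # w) ` (UNIV \<times> {w. length w = k})"
    by (auto simp: image_iff length_Suc_conv)
  then have "(\<Sum>w | length w = Suc k. f w) = (\<Sum>(x, w)\<in>UNIV \<times> {w. length w = k}. f (x # w))"
    by (simp add: sum.reindex inj_on_def case_prod_unfold)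
  then show ?thesis by (simp add: sum.cartesian_product)
qed

text \<open>Matrix powers unfold on the right, while words are built at the head.\<close>

lemma pow_mat_Suc_left:
  assumes "A \<in> carrier_mat n n"
  shows "A ^\<^sub>m Suc k = A * A ^\<^sub>m k"
proof (induction k)
  case 0
  then show ?case using assms by simp
next
  case (Suc k)
  have "A ^\<^sub>m Suc (Suc k) = A * A ^\<^sub>m k * A" using Suc by simp
  also have "\<dots> = A * (A ^\<^sub>m k * A)"
    using assms by (intro assoc_mult_mat[of _ n n _ n _ n]) auto
  finally show ?case by simp
qed

definition letter_coeff :: "complex \<Rightarrow> complex \<Rightarrow> complex \<Rightarrow> letter \<Rightarrow> complex" where
  "letter_coeff a b t x = (case x of LetC \<Rightarrow> a | LetCs \<Rightarrow> b | LetD \<Rightarrow> t)"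

text \<open>Noncommutative multinomial expansion, by splitting off the first letter. It is stated
  entrywise so that all sums are sums of scalars.\<close>

lemma pow_index_eq_sum_words:
  assumes C: "C \<in> carrier_mat n n" and ij: "i < n" "j < n"
    and M: "M \<in> carrier_mat n n"
    and Mx: "\<And>i j. i < n \<Longrightarrow> j < n \<Longrightarrow> M $$ (i,j) = (\<Sum>x\<in>UNIV. letter_coeff a b t x * letter_mat C x $$ (i,j))"
  shows "(M ^\<^sub>m k) $$ (i,j) =
    (\<Sum>w | length w = k. prod_list (map (letter_coeff a b t) w) * word_eval C w $$ (i,j))"
  using ij
proof (induction k arbitrary: i)
  case 0
  then show ?case using C M by (simp add: word_eval_Nil)
next
  case (Suc k)
  let ?c = "letter_coeff a b t" and ?p = "\<lambda>w. prod_list (map (letter_coeff a b t) w)"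
  have "(M ^\<^sub>m Suc k) $$ (i,j) = (\<Sum>l<n. M $$ (i,l) * (M ^\<^sub>m k) $$ (l,j))"
    unfolding pow_mat_Suc_left[OF M] using Suc.prems M
    by (simp add: scalar_prod_def atLeast0LessThan)
  also have "\<dots> = (\<Sum>l<n. \<Sum>x\<in>UNIV. \<Sum>w | length w = k.
      ?c x * ?p w * (letter_mat C x $$ (i,l) * word_eval C w $$ (l,j)))"
    using Suc by (intro sum.cong refl) (simp add: Mx sum_product algebra_simps)
  also have "\<dots> = (\<Sum>x\<in>UNIV. \<Sum>w | length w = k. \<Sum>l<n.
      ?c x * ?p w * (letter_mat C x $$ (i,l) * word_eval C w $$ (l,j)))"
    by (subst sum.swap, intro sum.cong refl, subst sum.swap, rule refl)
  also have "\<dots> = (\<Sum>x\<in>UNIV. \<Sum>w | length w = k. ?p (x # w) * word_eval C (x # w) $$ (i,j))"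
  proof (intro sum.cong refl)
    fix x and w :: "letter list"
    have "word_eval C (x # w) $$ (i,j) = (\<Sum>l<n. letter_mat C x $$ (i,l) * word_eval C w $$ (l,j))"
      unfolding word_eval_Cons using Suc.prems letter_mat_carrier[OF C, of x] word_eval_carrier[OF C, of w]
      by (simp add: scalar_prod_def atLeast0LessThan)
    then show "(\<Sum>l<n. ?c x * ?p w * (letter_mat C x $$ (i,l) * word_eval C w $$ (l,j))) =
        ?p (x # w) * word_eval C (x # w) $$ (i,j)"
      by (simp add: sum_distrib_left)
  qed
  finally show ?case unfolding sum_lists_length_Suc .
qed

lemma count_letters: "count_list w LetC + count_list w LetCs + count_list w LetD = length w"
proof (induction w)
  case (Cons x w)
  then show ?case by (cases x) auto
qed simp

lemma prod_letter_coeff: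
  "prod_list (map (letter_coeff a b t) w) =
    a ^ count_list w LetC * b ^ count_list w LetCs * t ^ count_list w LetD"
proof (induction w)
  case (Cons x w)
  then show ?case by (cases x) (auto simp: letter_coeff_def)
qed simp

text \<open>The weight of a word depends only on how often each letter occurs, so the expansion can
  be grouped by the numbers m of \<open>LetD\<close> and l of \<open>LetCs\<close>; the remaining k
  - m - l letters are \<open>LetC\<close>.\<close>

lemma mtrace_pow_eq_sum_Omega:
  assumes C: "C \<in> carrier_mat n n"
  shows "mtrace ((a \<cdot>\<^sub>m C + b \<cdot>\<^sub>m mat_adjoint C + t \<cdot>\<^sub>m defect C) ^\<^sub>m k) =
    (\<Sum>m\<le>k. (\<Sum>l\<le>k - m. a ^ (k - m - l) * b ^ l * Omega k m l C) * t ^ m)"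
proof -
  let ?M = "a \<cdot>\<^sub>m C + b \<cdot>\<^sub>m mat_adjoint C + t \<cdot>\<^sub>m defect C"
  let ?p = "\<lambda>w. prod_list (map (letter_coeff a b t) w)"
  let ?T = "Sigma {..k} (\<lambda>m. {..k - m})"
  let ?g = "\<lambda>w. (count_list w LetD, count_list w LetCs)"
  have M: "?M \<in> carrier_mat n n" using C by auto
  have Mx: "?M $$ (i,j) = (\<Sum>x\<in>UNIV. letter_coeff a b t x * letter_mat C x $$ (i,j))"
    if "i < n" "j < n" for i j
    using that C by (simp add: UNIV_letter letter_coeff_def letter_mat_def)
  have "mtrace (?M ^\<^sub>m k) = (\<Sum>i<n. \<Sum>w | length w = k. ?p w * word_eval C w $$ (i,i))"
    unfolding mtrace_def carrier_matD(1)[OF pow_carrier_mat[OF M]]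
    by (intro sum.cong refl pow_index_eq_sum_words[OF C _ _ M Mx]) auto
  also have "\<dots> = (\<Sum>w | length w = k. \<Sum>i<n. ?p w * word_eval C w $$ (i,i))"
    by (rule sum.swap)
  also have "\<dots> = (\<Sum>w | length w = k. ?p w * mtrace (word_eval C w))"
    unfolding mtrace_def carrier_matD(1)[OF word_eval_carrier[OF C]] by (simp add: sum_distrib_left)
  also have "\<dots> = (\<Sum>ml\<in>?T. \<Sum>w\<in>{w\<in>{w. length w = k}. ?g w = ml}. ?p w * mtrace (word_eval C w))"
  proof (rule sum.group[symmetric])
    show "?g ` {w. length w = k} \<subseteq> ?T"
    proof clarsimp
      fix w :: "letter list" assume "k = length w"
      then show "count_list w LetD \<le> length w \<and> count_list w LetCs \<le> length w - count_list w LetD"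
        using count_letters[of w] by linarith
    qed
  qed (auto intro: finite_letter_lists)
  also have "\<dots> = (\<Sum>(m,l)\<in>?T. a ^ (k - m - l) * b ^ l * t ^ m * Omega k m l C)"
  proof (intro sum.cong refl, unfold split_paired_all prod.case)
    fix m l
    have set: "{w\<in>{w. length w = k}. ?g w = (m,l)} = words k m l"
      unfolding words_def by auto
    have "?p w = a ^ (k - m - l) * b ^ l * t ^ m" if "w \<in> words k m l" for w
    proof -
      have "count_list w LetC = k - m - l"
        using that count_letters[of w] unfolding words_def by auto
      then show ?thesis using that unfolding prod_letter_coeff words_def by simp
    qed
    then show "(\<Sum>w\<in>{w\<in>{w. length w = k}. ?g w = (m,l)}. ?p w * mtrace (word_eval C w)) =
        a ^ (k - m - l) * b ^ l * t ^ m * Omega k m l C"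
      unfolding set Omega_def by (simp add: sum_distrib_left)
  qed
  also have "\<dots> = (\<Sum>m\<le>k. \<Sum>l\<le>k - m. a ^ (k - m - l) * b ^ l * t ^ m * Omega k m l C)"
    by (rule sum.Sigma[symmetric]) auto
  also have "\<dots> = (\<Sum>m\<le>k. (\<Sum>l\<le>k - m. a ^ (k - m - l) * b ^ l * Omega k m l C) * t ^ m)"
    unfolding sum_distrib_right by (intro sum.cong refl) (simp only: mult_ac)
  finally show ?thesis .
qed

section \<open>Independence of the angle by comparison of coefficients\<close>

lemma infinite_range_cis: "infinite (range cis)"
proof
  assume "finite (range cis)"
  then have "finite (Re ` range cis)" by (rule finite_imageI)
  moreover have "{-1..1} \<subseteq> Re ` range cis"
  proof
    fix y :: real
    assume "y \<in> {-1..1}"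
    then have "y = Re (cis (arccos y))" by simp
    then show "y \<in> Re ` range cis" by blast
  qed
  ultimately show False using infinite_Icc[of "-1::real" 1] finite_subset[of "{-1..1}" "Re ` range cis"] by linarith
qed

lemma poly_eq_on_infinite:
  fixes p q :: "'a :: idom poly"
  assumes "infinite S" "\<And>x. x \<in> S \<Longrightarrow> poly p x = poly q x"
  shows "p = q"
proof (rule ccontr)
  assume "p \<noteq> q"
  then have "finite {x. poly (p - q) x = 0}" by (intro poly_roots_finite) simp
  moreover have "S \<subseteq> {x. poly (p - q) x = 0}" using assms(2) by auto
  ultimately show False using assms(1) finite_subset by blast
qed

lemma Hmat_dim [simp]: "dim_row (Hmat X \<theta>) = dim_col X" "dim_col (Hmat X \<theta>) = dim_row X"
  unfolding Hmat_def by simp_all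

lemma Hmat_carrier [simp]: "X \<in> carrier_mat n n \<Longrightarrow> Hmat X \<theta> \<in> carrier_mat n n"
  unfolding Hmat_def by auto

lemma Hmat_eq_cis:
  assumes "X \<in> carrier_mat n n"
  shows "Hmat X \<theta> = (cis (- \<theta>) / 2) \<cdot>\<^sub>m X + (cis \<theta> / 2) \<cdot>\<^sub>m mat_adjoint X"
proof -
  have "exp (\<i> * of_real \<theta>) = cis \<theta>" "exp (- \<i> * of_real \<theta>) = cis (- \<theta>)"
    by (simp_all add: cis_conv_exp)
  then show ?thesis
    unfolding Hmat_def using assms by (intro eq_matI) (auto simp: algebra_simps)
qed

text \<open>The coefficient of t^m is a Laurent polynomial in \<open>cis \<theta>\<close> in which
  \<open>Omega k m l C\<close> belongs to the exponent 2l - (k - m). Different l give different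
  exponents, so it is constant iff only exponent 0 survives.\<close>

lemma mtrace_pow_rotation_invariant_iff_Omega:
  assumes C: "C \<in> carrier_mat n n"
  shows "(\<forall>t \<theta>. mtrace ((Hmat C \<theta> + t \<cdot>\<^sub>m defect C) ^\<^sub>m k) = mtrace ((Hmat C 0 + t \<cdot>\<^sub>m defect C) ^\<^sub>m k)) \<longleftrightarrow>
    (\<forall>m l. m \<le> k \<and> l \<le> k - m \<and> 2 * l \<noteq> k - m \<longrightarrow> Omega k m l C = 0)"
proof -
  define g where "g = (\<lambda>\<theta> m. \<Sum>l\<le>k - m. (cis (- \<theta>) / 2) ^ (k - m - l) * (cis \<theta> / 2) ^ l * Omega k m l C)"
  have tr: "mtrace ((Hmat C \<theta> + t \<cdot>\<^sub>m defect C) ^\<^sub>m k) = (\<Sum>m\<le>k. g \<theta> m * t ^ m)" for t \<theta>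
    unfolding Hmat_eq_cis[OF C] mtrace_pow_eq_sum_Omega[OF C] g_def ..
  \<comment> \<open>The factor \<open>(2 * cis \<theta>) ^ (k - m)\<close> clears both the powers of
    2 and the negative exponents.\<close>
  have weight: "(cis (- \<theta>) / 2) ^ (k - m - l) * (cis \<theta> / 2) ^ l * (2 * cis \<theta>) ^ (k - m) = cis \<theta> ^ (2 * l)"
    if "l \<le> k - m" for \<theta> m l
  proof -
    define q where "q = k - m - l"
    have q: "k - m = q + l" using that by (simp add: q_def)
    have "(cis (- \<theta>) / 2) * (2 * cis \<theta>) = 1"
      by (simp add: cis_mult)
    then have "(cis (- \<theta>) / 2) ^ q * (2 * cis \<theta>) ^ q = 1"
      by (metis power_mult_distrib power_one)
    moreover have "(cis \<theta> / 2) * (2 * cis \<theta>) = cis \<theta> ^ 2"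
      by (simp add: power2_eq_square)
    then have "(cis \<theta> / 2) ^ l * (2 * cis \<theta>) ^ l = cis \<theta> ^ (2 * l)"
      by (metis power_mult_distrib power_mult)
    moreover have "(cis (- \<theta>) / 2) ^ q * (cis \<theta> / 2) ^ l * (2 * cis \<theta>) ^ (q + l) =
        ((cis (- \<theta>) / 2) ^ q * (2 * cis \<theta>) ^ q) * ((cis \<theta> / 2) ^ l * (2 * cis \<theta>) ^ l)"
      unfolding power_add by (simp only: mult_ac)
    ultimately show ?thesis unfolding q by (simp only: mult_1 add_diff_cancel_right')
  qed
  have coeffs: "(\<forall>t. (\<Sum>m\<le>k. g \<theta> m * t ^ m) = (\<Sum>m\<le>k. g 0 m * t ^ m)) \<longleftrightarrow>
      (\<forall>m\<le>k. g \<theta> m = g 0 m)" for \<theta>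
    by (rule polyfun_eq_coeffs)
  have "(\<forall>t \<theta>. (\<Sum>m\<le>k. g \<theta> m * t ^ m) = (\<Sum>m\<le>k. g 0 m * t ^ m)) \<longleftrightarrow> (\<forall>m\<le>k. \<forall>\<theta>. g \<theta> m = g 0 m)"
    by (subst all_comm, unfold coeffs) blast
  also have "\<dots> \<longleftrightarrow> (\<forall>m l. m \<le> k \<and> l \<le> k - m \<and> 2 * l \<noteq> k - m \<longrightarrow> Omega k m l C = 0)"
  proof (intro iffI allI impI)
    fix m l
    assume inv: "\<forall>m\<le>k. \<forall>\<theta>. g \<theta> m = g 0 m" and ml: "m \<le> k \<and> l \<le> k - m \<and> 2 * l \<noteq> k - m"
    \<comment> \<open>This is the Laurent polynomial after clearing, in the variable x =
      \<open>cis \<theta>\<close>. Invariance leaves only its monomial of degree k - m, hence no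
      term of degree 2l.\<close>
    define p where "p = (\<Sum>l\<le>k - m. monom (Omega k m l C) (2 * l))"
    have "p = monom (2 ^ (k - m) * g 0 m) (k - m)"
    proof (rule poly_eq_on_infinite[OF infinite_range_cis])
      fix x assume "x \<in> range cis"
      then obtain \<theta> where x: "x = cis \<theta>" by blast
      have "poly p x = (\<Sum>l\<le>k - m. Omega k m l C * cis \<theta> ^ (2 * l))"
        by (simp add: p_def poly_sum poly_monom x)
      also have "\<dots> = (2 * cis \<theta>) ^ (k - m) * g \<theta> m"
        unfolding g_def sum_distrib_left 
      proof (intro sum.cong refl)
        fix l assume "l \<in> {..k - m}"
        then have l: "l \<le> k - m" by simp
        show "Omega k m l C * cis \<theta> ^ (2 * l) = (2 * cis \<theta>) ^ (k - m) *
            ((cis (- \<theta>) / 2) ^ (k - m - l) * (cis \<theta> / 2) ^ l * Omega k m l C)"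
          by (subst weight[OF l, symmetric]) (simp only: mult_ac)
      qed
      also have "\<dots> = poly (monom (2 ^ (k - m) * g 0 m) (k - m)) x"
        using inv[rule_format, of m \<theta>] ml by (simp add: poly_monom x power_mult_distrib)
      finally show "poly p x = poly (monom (2 ^ (k - m) * g 0 m) (k - m)) x" .
    qed
    then have "coeff p (2 * l) = 0" using ml by simp
    moreover have "coeff p (2 * l) = (\<Sum>l'\<le>k - m. if l' = l then Omega k m l' C else 0)"
      unfolding p_def coeff_sum by (intro sum.cong refl) simp
    ultimately show "Omega k m l C = 0" using ml by simp
  next
    fix m \<theta>
    assume "\<forall>m l. m \<le> k \<and> l \<le> k - m \<and> 2 * l \<noteq> k - m \<longrightarrow> Omega k m l C = 0" and "m \<le> k"
    then have zero: "2 * l \<noteq> k - m \<Longrightarrow> l \<le> k - m \<Longrightarrow> Omega k m l C = 0" for l by blast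
    \<comment> \<open>With equally many letters \<open>LetC\<close> and \<open>LetCs\<close> the
      phases cancel.\<close>
    have balanced: "(cis (- \<theta>) / 2) ^ (k - m - l) * (cis \<theta> / 2) ^ l = (1/4) ^ l" if "2 * l = k - m" for l \<theta>
    proof -
      have l: "k - m - l = l" using that by simp
      have "(cis (- \<theta>) / 2) * (cis \<theta> / 2) = 1/4" by (simp add: cis_mult)
      then show ?thesis unfolding l power_mult_distrib[symmetric] by (rule arg_cong)
    qed
    show "g \<theta> m = g 0 m"
      unfolding g_def
    proof (intro sum.cong refl)
      fix l assume "l \<in> {..k - m}"
      then show "(cis (- \<theta>) / 2) ^ (k - m - l) * (cis \<theta> / 2) ^ l * Omega k m l C =
          (cis (- 0) / 2) ^ (k - m - l) * (cis 0 / 2) ^ l * Omega k m l C"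
        using zero[of l] by (cases "2 * l = k - m") (simp_all only: balanced atMost_iff mult_zero_right simp_thms)
    qed
  qed
  finally show ?thesis unfolding tr .
qed

subsection \<open>Factorization of the defect\<close>

text \<open>A sesquilinear form on plain functions, so that elimination can replace the coefficients
  \<open>d\<close> without matrix dimensions to maintain.\<close>

definition sesq :: "nat \<Rightarrow> (nat \<Rightarrow> nat \<Rightarrow> complex) \<Rightarrow> (nat \<Rightarrow> complex) \<Rightarrow> (nat \<Rightarrow> complex) \<Rightarrow> complex" where
  "sesq n d x y = (\<Sum>i<n. \<Sum>j<n. cnj (x i) * d i j * y j)"

lemma sesq_add_left: "sesq n d (\<lambda>i. x i + c * x' i) y = sesq n d x y + cnj c * sesq n d x' y"
  unfolding sesq_def sum_distrib_left sum.distrib[symmetric]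
  by (intro sum.cong refl) (simp add: algebra_simps)

lemma sesq_add_right: "sesq n d x (\<lambda>i. y i + c * y' i) = sesq n d x y + c * sesq n d x y'"
  unfolding sesq_def sum_distrib_left sum.distrib[symmetric]
  by (intro sum.cong refl) (simp add: algebra_simps)

lemma sum_of_bool_eq:
  fixes f :: "nat \<Rightarrow> complex"
  assumes "k < n"
  shows "(\<Sum>j<n. f j * of_bool (j = k)) = f k"
proof -
  have "(\<Sum>j<n. f j * of_bool (j = k)) = (\<Sum>j<n. if j = k then f j else 0)"
    by (intro sum.cong refl) auto
  then show ?thesis using assms by simp
qed

lemma sesq_unit_right: "k < n \<Longrightarrow> sesq n d x (\<lambda>i. of_bool (i = k)) = (\<Sum>i<n. cnj (x i) * d i k)"
  unfolding sesq_def by (simp add: sum_of_bool_eq)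

lemma sesq_unit_left:
  assumes "k < n"
  shows "sesq n d (\<lambda>i. of_bool (i = k)) y = (\<Sum>j<n. d k j * y j)"
proof -
  have "sesq n d (\<lambda>i. of_bool (i = k)) y = (\<Sum>i<n. (\<Sum>j<n. d i j * y j) * of_bool (i = k))"
    unfolding sesq_def sum_distrib_right by (intro sum.cong refl) simp
  then show ?thesis using sum_of_bool_eq[OF assms] by simp
qed

lemma sesq_unit_unit:
  assumes "k < n" "l < n"
  shows "sesq n d (\<lambda>i. of_bool (i = k)) (\<lambda>i. of_bool (i = l)) = d k l"
  unfolding sesq_unit_left[OF assms(1)] by (rule sum_of_bool_eq[OF assms(2)])

lemma psd_zero_diag_imp_zero_row:
  assumes herm: "\<And>i j. i < n \<Longrightarrow> j < n \<Longrightarrow> d j i = cnj (d i j)"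
    and psd: "\<And>x. 0 \<le> Re (sesq n d x x)"
    and k: "k < n" "d k k = 0" and i: "i < n"
  shows "d k i = 0"
proof (rule ccontr)
  assume nz: "d k i \<noteq> 0"
  \<comment> \<open>Chosen so that the form at the test vector \<open>?x\<close> has real part -1,
    contradicting positivity.\<close>
  define y where "y = (Re (d i i) + 1) / (2 * (cmod (d k i))\<^sup>2)"
  let ?e = "\<lambda>m i. of_bool (i = m) :: complex"
  let ?x = "\<lambda>j. ?e i j + (- of_real y * d k i) * ?e k j"
  have "sesq n d ?x ?x = d i i - of_real (2 * y * (cmod (d k i))\<^sup>2)"
    unfolding sesq_add_left sesq_add_right sesq_unit_unit[OF k(1) i] sesq_unit_unit[OF i k(1)]
      sesq_unit_unit[OF k(1) k(1)] sesq_unit_unit[OF i i] k(2)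
    using herm[OF k(1) i] by (simp add: complex_norm_square[symmetric] algebra_simps)
  then have "Re (sesq n d ?x ?x) = Re (d i i) - 2 * y * (cmod (d k i))\<^sup>2" by simp
  also have "2 * y * (cmod (d k i))\<^sup>2 = Re (d i i) + 1" using nz by (simp add: y_def)
  finally show False using psd[of ?x] by simp
qed

text \<open>Cholesky elimination of the coordinates from the last to the first. The family \<open>w\<close>, dual to the
rows \<open>b\<close>, witnesses that the rows are linearly independent.\<close>

lemma psd_gram_representation:
  assumes herm: "\<And>i j. i < n \<Longrightarrow> j < n \<Longrightarrow> d j i = cnj (d i j)"
    and psd: "\<And>x. 0 \<le> Re (sesq n d x x)"
    and zero: "\<And>i j. i < n \<Longrightarrow> j < n \<Longrightarrow> k \<le> j \<Longrightarrow> d i j = 0" and k: "k \<le> n"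
  shows "\<exists>(r::nat) b w. (\<forall>i<n. \<forall>j<n. d i j = (\<Sum>s<r. cnj (b s i) * b s j)) \<and>
    (\<forall>s<r. \<forall>s'<r. (\<Sum>i<n. b s i * w s' i) = of_bool (s = s'))"
  using assms
proof (induction k arbitrary: d)
  case 0
  then show ?case by (intro exI[of _ "0::nat"]) auto
next
  case (Suc k)
  note herm = Suc.prems(1) and psd = Suc.prems(2) and zero = Suc.prems(3)
  have kn: "k < n" using Suc.prems(4) by simp
  let ?e = "\<lambda>i. of_bool (i = k) :: complex"
  define a where "a = Re (d k k)"
  have dkk: "d k k = of_real a"
    using arg_cong[OF herm[OF kn kn], of Im] by (simp add: a_def complex_eq_iff)
  have ekk: "sesq n d ?e ?e = of_real a"
    unfolding sesq_unit_unit[OF kn kn] by (rule dkk)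
  then have a0: "0 \<le> a" using psd[of ?e] by simp
  show ?case
  proof (cases "a = 0")
    case True
    \<comment> \<open>A zero pivot forces column k to vanish, so there is nothing to eliminate and
      the induction hypothesis applies to \<open>d\<close> itself.\<close>
    have "d i k = 0" if "i < n" for i
      using psd_zero_diag_imp_zero_row[OF herm psd kn _ that] dkk True herm[OF kn that] by simp
    then have zero_k: "d i j = 0" if "i < n" "j < n" "k \<le> j" for i j
      using zero[of i j] that by (cases "j = k") auto
    show ?thesis by (rule Suc.IH[OF herm psd zero_k less_imp_le[OF kn]])
  next
    case False
    then have a: "a > 0" using a0 by simp
    \<comment> \<open>The Schur complement with respect to the pivot \<open>a\<close>; its row and
      column k vanish.\<close>
    define d' where "d' = (\<lambda>i j. d i j - d i k * d k j / of_real a)"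
    have herm': "d' j i = cnj (d' i j)" if "i < n" "j < n" for i j
      using herm[OF that] herm[OF kn that(1)] herm[OF that(2) kn] by (simp add: d'_def mult.commute)
    have psd': "0 \<le> Re (sesq n d' x x)" for x
    proof -
      define S where "S = (\<Sum>j<n. d k j * x j)"
      have cS: "(\<Sum>i<n. cnj (x i) * d i k) = cnj S"
        unfolding S_def cnj_sum using herm[OF kn] by (intro sum.cong refl) (simp add: mult.commute)
      have "sesq n d' x x = sesq n d x x - (\<Sum>i<n. \<Sum>j<n. (cnj (x i) * d i k) * (d k j * x j)) / of_real a"
        unfolding sesq_def d'_def sum_divide_distrib sum_subtractf[symmetric]
        by (intro sum.cong refl) (simp add: algebra_simps)
      also have "\<dots> = sesq n d x x - cnj S * S / of_real a"
        unfolding sum_product[symmetric] cS by (simp add: S_def)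
      \<comment> \<open>Completing the square: \<open>d'\<close> at x is \<open>d\<close> at x
        shifted along coordinate k, so positivity is inherited.\<close>
      also have "\<dots> = sesq n d (\<lambda>i. x i + (- S / of_real a) * ?e i) (\<lambda>i. x i + (- S / of_real a) * ?e i)"
        unfolding sesq_add_left sesq_add_right sesq_unit_unit[OF kn kn] dkk
          sesq_unit_left[OF kn] sesq_unit_right[OF kn] cS S_def[symmetric]
        using a by (simp add: field_simps)
      finally show ?thesis using psd by simp
    qed
    have zero': "d' i j = 0" if "i < n" "j < n" "k \<le> j" for i j
      using zero[of i j] zero[of k j] that kn a dkk by (cases "j = k") (auto simp: d'_def)
    obtain r :: nat and b w where
      "(\<forall>i<n. \<forall>j<n. d' i j = (\<Sum>s<r. cnj (b s i) * b s j)) \<and>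
        (\<forall>s<r. \<forall>s'<r. (\<Sum>i<n. b s i * w s' i) = of_bool (s = s'))"
      using Suc.IH[OF herm' psd' zero' less_imp_le[OF kn]] by blast
    then have b: "\<And>i j. i < n \<Longrightarrow> j < n \<Longrightarrow> d' i j = (\<Sum>s<r. cnj (b s i) * b s j)"
      and w: "\<And>s s'. s < r \<Longrightarrow> s' < r \<Longrightarrow> (\<Sum>i<n. b s i * w s' i) = of_bool (s = s')"
      by blast+
    \<comment> \<open>The vanishing entry \<open>d' k k\<close> is the sum of the squares of the
      moduli of \<open>b s k\<close>.\<close>
    have bk: "b s k = 0" if "s < r" for s
    proof -
      have "of_real (\<Sum>s<r. (cmod (b s k))\<^sup>2) = d' k k"
        unfolding b[OF kn kn] of_real_sum by (intro sum.cong refl) (simp only: complex_norm_square mult.commute)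
      then have "(\<Sum>s<r. (cmod (b s k))\<^sup>2) = 0"
        using zero'[OF kn kn] by (metis of_real_eq_0_iff order_refl)
      then show ?thesis using that by (simp add: sum_nonneg_eq_0_iff)
    qed
    define q where "q = complex_of_real (sqrt a)"
    have q: "q * q = of_real a" "q \<noteq> 0" "cnj q = q"
      using a by (auto simp: q_def simp flip: of_real_mult)
    define br where "br = (\<lambda>i. d k i / q)"
    define wr where "wr = (\<lambda>i. ?e i / q)"
    define c where "c = (\<lambda>s. \<Sum>i<n. br i * w s i)"
    define b' where "b' = b(r := br)"
    \<comment> \<open>\<open>wr\<close> is dual to the new row and annihilated by the old ones, by
      \<open>bk\<close>. Subtracting \<open>c s * wr i\<close> makes the old dual vectors annihilate
      the new row.\<close>
    define w' where "w' = (\<lambda>s i. if s = r then wr i else w s i - c s * wr i)"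
    have brwr: "(\<Sum>i<n. br i * wr i) = 1"
    proof -
      have "(\<Sum>i<n. br i * wr i) = (\<Sum>i<n. (d k i / of_real a) * ?e i)"
        unfolding br_def wr_def q(1)[symmetric] by simp
      also have "\<dots> = d k k / of_real a" by (rule sum_of_bool_eq[OF kn])
      finally show ?thesis using a dkk by simp
    qed
    have bwr: "(\<Sum>i<n. b s i * wr i) = 0" if "s < r" for s
    proof -
      have "(\<Sum>i<n. b s i * wr i) = (\<Sum>i<n. (b s i / q) * ?e i)"
        unfolding wr_def by simp
      also have "\<dots> = b s k / q" by (rule sum_of_bool_eq[OF kn])
      finally show ?thesis using bk[OF that] by simp
    qed
    have gram: "d i j = (\<Sum>s<Suc r. cnj (b' s i) * b' s j)" if "i < n" "j < n" for i j
    proof -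
      have "(\<Sum>s<Suc r. cnj (b' s i) * b' s j) = d' i j + cnj (br i) * br j"
        using b[OF that] by (simp add: b'_def)
      also have "cnj (br i) * br j = d i k * d k j / of_real a"
        using herm[OF kn that(1)] by (simp add: br_def q(3) flip: q(1))
      finally show ?thesis by (simp add: d'_def)
    qed
    have dual: "(\<Sum>i<n. b' s i * w' s' i) = of_bool (s = s')" if "s < Suc r" "s' < Suc r" for s s'
    proof -
      have *: "(\<Sum>i<n. f i * (w s' i - c s' * wr i)) = (\<Sum>i<n. f i * w s' i) - c s' * (\<Sum>i<n. f i * wr i)" for f
        unfolding sum_distrib_left sum_subtractf[symmetric]
        by (intro sum.cong refl) (simp add: algebra_simps)
      have cr: "(\<Sum>i<n. br i * w s i) = c s" for s by (simp add: c_def)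
      consider "s = r" "s' = r" | "s = r" "s' < r" | "s < r" "s' = r" | "s < r" "s' < r"
        using \<open>s < Suc r\<close> \<open>s' < Suc r\<close> by linarith
      then show ?thesis
        by cases (simp_all add: b'_def w'_def brwr bwr * w cr)
    qed
    show ?thesis
      by (intro exI[of _ "Suc r"] exI[of _ b'] exI[of _ w'] conjI allI impI gram dual)
  qed
qed

section \<open>Rank and the full-rank factorization\<close>

lemma (in vec_space) rank_eq_ncols_if_left_inverse:
  assumes A: "A \<in> carrier_mat n nc" and L: "L \<in> carrier_mat nc n" and LA: "L * A = 1\<^sub>m nc"
  shows "rank A = nc"
proof (rule lin_indpt_full_rank[OF A])
  have inj: "u = v" if "u \<in> carrier_vec nc" "v \<in> carrier_vec nc" "A *\<^sub>v u = A *\<^sub>v v" for u v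
  proof -
    have "L *\<^sub>v (A *\<^sub>v x) = x" if "x \<in> carrier_vec nc" for x
      using assoc_mult_mat_vec[OF L A that] that by (simp add: LA)
    then show ?thesis using that by metis
  qed
  \<comment> \<open>Linear independence is a property of the set of columns, so a repeated column
    has to be excluded separately.\<close>
  show dist: "distinct (cols A)"
  proof (unfold distinct_conv_nth, intro allI impI)
    fix i j
    assume ij: "i < length (cols A)" "j < length (cols A)" "i \<noteq> j"
    then have l: "i < nc" "j < nc" using A by auto
    have "A *\<^sub>v unit_vec nc i = col A i" "A *\<^sub>v unit_vec nc j = col A j"
      using l A by (auto intro!: eq_vecI)
    then have "col A i \<noteq> col A j"
      using inj[of "unit_vec nc i" "unit_vec nc j"] l ij(3) by auto
    then show "cols A ! i \<noteq> cols A ! j" using ij by simp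
  qed
  show "lin_indpt (set (cols A))"
  proof
    assume "lin_dep (set (cols A))"
    then obtain v where v: "v \<in> carrier_vec nc" "v \<noteq> 0\<^sub>v nc" "A *\<^sub>v v = 0\<^sub>v n"
      using lin_depE[OF A _ dist] by blast
    moreover have "A *\<^sub>v 0\<^sub>v nc = 0\<^sub>v n" using A by auto
    ultimately show False using inj[of v "0\<^sub>v nc"] by simp
  qed
qed

lemma (in vec_space) rank_eq_if_col_space_eq:
  "col_space A = col_space B \<Longrightarrow> rank A = rank B"
  unfolding rank_def col_space_def by simp

text \<open>The Gram rows form \<open>B\<close> and the dual family forms a right inverse
  \<open>W\<close>. This identifies the number r of rows with the rank of \<open>D\<close> and also
  with the rank of \<open>B\<close>.\<close>

lemma psd_mat_factorization:
  assumes D: "D \<in> carrier_mat n n"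
    and herm: "\<And>i j. i < n \<Longrightarrow> j < n \<Longrightarrow> D $$ (j,i) = cnj (D $$ (i,j))"
    and psd: "\<And>x. 0 \<le> Re (sesq n (\<lambda>i j. D $$ (i,j)) x x)"
  shows "\<exists>B \<in> carrier_mat (vec_space.rank n D) n.
    vec_space.rank (dim_row B) B = vec_space.rank n D \<and> mat_adjoint B * B = D"
proof -
  obtain r :: nat and b w where
    "(\<forall>i<n. \<forall>j<n. D $$ (i,j) = (\<Sum>s<r. cnj (b s i) * b s j)) \<and>
      (\<forall>s<r. \<forall>s'<r. (\<Sum>i<n. b s i * w s' i) = of_bool (s = s'))"
    using psd_gram_representation[of n "\<lambda>i j. D $$ (i,j)" n, OF herm psd] by auto
  then have b: "\<And>i j. i < n \<Longrightarrow> j < n \<Longrightarrow> D $$ (i,j) = (\<Sum>s<r. cnj (b s i) * b s j)"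
    and w: "\<And>s s'. s < r \<Longrightarrow> s' < r \<Longrightarrow> (\<Sum>i<n. b s i * w s' i) = of_bool (s = s')"
    by blast+
  define B where "B = mat r n (\<lambda>(s,i). b s i)"
  define W where "W = mat n r (\<lambda>(i,s). w s i)"
  have B: "B \<in> carrier_mat r n" and W: "W \<in> carrier_mat n r"
    by (auto simp: B_def W_def)
  have BB: "mat_adjoint B * B = D"
    using D by (intro eq_matI) (auto simp: B_def scalar_prod_def atLeast0LessThan b)
  have BW: "B * W = 1\<^sub>m r"
    by (intro eq_matI) (auto simp: B_def W_def scalar_prod_def atLeast0LessThan w)
  \<comment> \<open>Together with \<open>BB\<close> this shows that \<open>D\<close> and the adjoint
    of \<open>B\<close> have the same column space.\<close>
  have DW: "D * W = mat_adjoint B"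
    unfolding BB[symmetric] using assoc_mult_mat[OF adjoint_carrier[OF B] B W] B by (simp add: BW)
  have "mat_adjoint W * mat_adjoint B = 1\<^sub>m r"
  proof (intro eq_matI)
    fix i j assume "i < dim_row (1\<^sub>m r :: complex mat)" "j < dim_col (1\<^sub>m r :: complex mat)"
    then have ij: "i < r" "j < r" by auto
    have "(mat_adjoint W * mat_adjoint B) $$ (i,j) = cnj (\<Sum>l<n. b j l * w i l)"
      using ij by (simp add: B_def W_def scalar_prod_def atLeast0LessThan mult.commute)
    then show "(mat_adjoint W * mat_adjoint B) $$ (i,j) = 1\<^sub>m r $$ (i,j)"
      using w[OF ij(2,1)] ij by auto
  qed (use B W in auto)
  then have rank_adj: "vec_space.rank n (mat_adjoint B) = r"
    using vec_space.rank_eq_ncols_if_left_inverse[OF adjoint_carrier[OF B] adjoint_carrier[OF W]] by simp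
  have "vec_space.col_space n D = vec_space.col_space n (mat_adjoint B)"
    unfolding vec_space.col_space_eq[OF D] vec_space.col_space_eq[OF adjoint_carrier[OF B]]
  proof (intro Collect_cong conj_cong)
    fix y
    show "(\<exists>x\<in>carrier_vec (dim_col D). D *\<^sub>v x = y) \<longleftrightarrow>
        (\<exists>x\<in>carrier_vec (dim_col (mat_adjoint B)). mat_adjoint B *\<^sub>v x = y)"
    proof (intro iffI; elim bexE)
      fix x assume "x \<in> carrier_vec (dim_col D)" "D *\<^sub>v x = y"
      then show "\<exists>x\<in>carrier_vec (dim_col (mat_adjoint B)). mat_adjoint B *\<^sub>v x = y"
        using assoc_mult_mat_vec[OF adjoint_carrier[OF B] B, of x] B D BB
        by (intro bexI[of _ "B *\<^sub>v x"]) auto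
    next
      fix x assume "x \<in> carrier_vec (dim_col (mat_adjoint B))" "mat_adjoint B *\<^sub>v x = y"
      then show "\<exists>x\<in>carrier_vec (dim_col D). D *\<^sub>v x = y"
        using assoc_mult_mat_vec[OF D W, of x] B D W DW
        by (intro bexI[of _ "W *\<^sub>v x"]) auto
    qed
  qed (use B D in auto)
  then have rank_D: "vec_space.rank n D = r"
    using vec_space.rank_eq_if_col_space_eq rank_adj by metis
  have one: "(1\<^sub>m r :: complex mat) \<in> carrier_mat r r" by simp
  \<comment> \<open>The right inverse makes \<open>B\<close> surjective.\<close>
  have "vec_space.col_space r B = vec_space.col_space r (1\<^sub>m r)"
    unfolding vec_space.col_space_eq[OF B] vec_space.col_space_eq[OF one]
  proof (intro Collect_cong conj_cong)
    fix y :: "complex vec" assume y: "y \<in> carrier_vec (dim_row (1\<^sub>m r :: complex mat))"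
    then have "B *\<^sub>v (W *\<^sub>v y) = y" using assoc_mult_mat_vec[OF B W, of y] by (simp add: BW)
    then have "\<exists>x\<in>carrier_vec (dim_col B). B *\<^sub>v x = y"
      using B W y mult_mat_vec_carrier[OF W] by (intro bexI[of _ "W *\<^sub>v y"]) auto
    moreover have "\<exists>x\<in>carrier_vec (dim_col (1\<^sub>m r :: complex mat)). 1\<^sub>m r *\<^sub>v x = y"
      using y by (intro bexI[of _ y]) auto
    ultimately show "(\<exists>x\<in>carrier_vec (dim_col B). B *\<^sub>v x = y) \<longleftrightarrow>
        (\<exists>x\<in>carrier_vec (dim_col (1\<^sub>m r :: complex mat)). 1\<^sub>m r *\<^sub>v x = y)" by blast
  qed (use B in auto)
  then have "vec_space.rank r B = vec_space.rank r (1\<^sub>m r :: complex mat)"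
    by (rule vec_space.rank_eq_if_col_space_eq)
  also have "\<dots> = r"
    using vec_space.rank_eq_ncols_if_left_inverse[OF one one] by simp
  finally show ?thesis using B BB rank_D by (intro bexI[of _ B]) auto
qed

text \<open>Translates between contractivity and positivity of the defect; it is applied in both
  directions.\<close>

lemma sesq_defect:
  assumes C: "C \<in> carrier_mat m n"
  shows "sesq n (\<lambda>i j. defect C $$ (i,j)) x x =
    of_real (vnorm2 (vec n x) - vnorm2 (C *\<^sub>v vec n x))"
proof -
  let ?y = "\<lambda>l. \<Sum>j<n. C $$ (l,j) * x j"
  have norm: "of_real (vnorm2 v) = (\<Sum>i<dim_vec v. cnj (v $ i) * v $ i)" for v
    unfolding vnorm2_def of_real_sum by (intro sum.cong refl) (simp only: complex_norm_square mult.commute)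
  have D: "defect C $$ (i,j) = of_bool (j = i) - (\<Sum>l<m. cnj (C $$ (l,i)) * C $$ (l,j))"
    if "i < n" "j < n" for i j
    using that C by (auto simp: defect_def scalar_prod_def atLeast0LessThan)
  have "sesq n (\<lambda>i j. defect C $$ (i,j)) x x =
      (\<Sum>i<n. \<Sum>j<n. cnj (x i) * x j * of_bool (j = i)) -
      (\<Sum>i<n. \<Sum>j<n. \<Sum>l<m. cnj (C $$ (l,i) * x i) * (C $$ (l,j) * x j))"
    unfolding sesq_def sum_subtractf[symmetric]
    by (intro sum.cong refl) (simp add: D sum_distrib_left sum_distrib_right algebra_simps)
  also have "(\<Sum>i<n. \<Sum>j<n. cnj (x i) * x j * of_bool (j = i)) = (\<Sum>i<n. cnj (x i) * x i)"
    by (intro sum.cong refl sum_of_bool_eq) simp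
  also have "\<dots> = of_real (vnorm2 (vec n x))"
    unfolding norm by simp
  also have "(\<Sum>i<n. \<Sum>j<n. \<Sum>l<m. cnj (C $$ (l,i) * x i) * (C $$ (l,j) * x j)) =
      (\<Sum>l<m. \<Sum>i<n. \<Sum>j<n. cnj (C $$ (l,i) * x i) * (C $$ (l,j) * x j))"
    by (subst (2) sum.swap, subst sum.swap, rule refl)
  also have "\<dots> = (\<Sum>l<m. cnj (?y l) * ?y l)"
    unfolding cnj_sum sum_product ..
  also have "\<dots> = of_real (vnorm2 (C *\<^sub>v vec n x))"
    unfolding norm using C by (simp add: scalar_prod_def atLeast0LessThan)
  finally show ?thesis by simp
qed

text \<open>The choice by \<open>SOME\<close> is justified because the defect of a contraction is
  Hermitian and positive semidefinite.\<close>

lemma Bmat_properties: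
  assumes C: "C \<in> carrier_mat m n" and "contraction C"
  shows "Bmat C \<in> carrier_mat (defect_rank C) n" "mat_adjoint (Bmat C) * Bmat C = defect C"
proof -
  have herm: "defect C $$ (j,i) = cnj (defect C $$ (i,j))" if "i < n" "j < n" for i j
    using that C by (auto simp: defect_def scalar_prod_def mult.commute)
  have psd: "0 \<le> Re (sesq n (\<lambda>i j. defect C $$ (i,j)) x x)" for x
    unfolding sesq_defect[OF C] using assms by (auto simp: contraction_def)
  have "\<exists>B. B \<in> carrier_mat (defect_rank C) (dim_col C) \<and>
      vec_space.rank (dim_row B) B = defect_rank C \<and> mat_adjoint B * B = defect C"
    using psd_mat_factorization[OF defect_carrier[OF C] herm psd] C unfolding defect_rank_def by auto
  from someI_ex[OF this] C show "Bmat C \<in> carrier_mat (defect_rank C) n"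
    "mat_adjoint (Bmat C) * Bmat C = defect C"
    unfolding Bmat_def[symmetric] by auto
qed

subsection \<open>The pencil along the tower\<close>

lemma adjoint_four_block_mat:
  assumes "P \<in> carrier_mat a b" "Q \<in> carrier_mat a c" "R \<in> carrier_mat e b" "S \<in> carrier_mat e c"
  shows "mat_adjoint (four_block_mat P Q R S) =
    four_block_mat (mat_adjoint P) (mat_adjoint R) (mat_adjoint Q) (mat_adjoint S)"
  using assms by (intro eq_matI) auto

text \<open>Schur complement: a block column operation \<open>?U\<close> of determinant 1 clears the
  upper right block.\<close>

lemma det_four_block_scalar_upper_left:
  fixes Q R S :: "complex mat"
  assumes c: "c \<noteq> 0" and Q: "Q \<in> carrier_mat d m" and R: "R \<in> carrier_mat m d" and S: "S \<in> carrier_mat m m"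
  shows "det (four_block_mat (c \<cdot>\<^sub>m 1\<^sub>m d) Q R S) = c ^ d * det (S - (1 / c) \<cdot>\<^sub>m (R * Q))"
proof -
  let ?M = "four_block_mat (c \<cdot>\<^sub>m 1\<^sub>m d) Q R S"
  let ?U = "four_block_mat (1\<^sub>m d) ((- 1 / c) \<cdot>\<^sub>m Q) (0\<^sub>m m d) (1\<^sub>m m)"
  let ?T = "S - (1 / c) \<cdot>\<^sub>m (R * Q)"
  have M: "?M \<in> carrier_mat (d + m) (d + m)" and U: "?U \<in> carrier_mat (d + m) (d + m)"
    using S by auto
  have "?M * ?U = four_block_mat (c \<cdot>\<^sub>m 1\<^sub>m d * 1\<^sub>m d + Q * 0\<^sub>m m d) (c \<cdot>\<^sub>m 1\<^sub>m d * ((- 1 / c) \<cdot>\<^sub>m Q) + Q * 1\<^sub>m m)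
      (R * 1\<^sub>m d + S * 0\<^sub>m m d) (R * ((- 1 / c) \<cdot>\<^sub>m Q) + S * 1\<^sub>m m)"
    by (rule mult_four_block_mat) (use Q R S in auto)
  also have "c \<cdot>\<^sub>m 1\<^sub>m d * 1\<^sub>m d + Q * 0\<^sub>m m d = c \<cdot>\<^sub>m 1\<^sub>m d"
    using Q by auto
  also have "c \<cdot>\<^sub>m 1\<^sub>m d * ((- 1 / c) \<cdot>\<^sub>m Q) + Q * 1\<^sub>m m = 0\<^sub>m d m"
  proof -
    have "c \<cdot>\<^sub>m 1\<^sub>m d * ((- 1 / c) \<cdot>\<^sub>m Q) = c \<cdot>\<^sub>m (1\<^sub>m d * ((- 1 / c) \<cdot>\<^sub>m Q))"
      using Q by (intro mult_smult_assoc_mat[of _ d d _ m]) auto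
    also have "1\<^sub>m d * ((- 1 / c) \<cdot>\<^sub>m Q) = (- 1 / c) \<cdot>\<^sub>m Q" using Q by simp
    finally show ?thesis using Q c by (intro eq_matI) auto
  qed
  also have "R * 1\<^sub>m d + S * 0\<^sub>m m d = R"
    using R S by auto
  also have "R * ((- 1 / c) \<cdot>\<^sub>m Q) + S * 1\<^sub>m m = ?T"
  proof -
    have "R * ((- 1 / c) \<cdot>\<^sub>m Q) = (- 1 / c) \<cdot>\<^sub>m (R * Q)"
      by (rule mult_smult_distrib[OF R Q])
    then show ?thesis using Q R S by (intro eq_matI) auto
  qed
  finally have "?M * ?U = four_block_mat (c \<cdot>\<^sub>m 1\<^sub>m d) (0\<^sub>m d m) R ?T" .
  moreover have "det (four_block_mat (c \<cdot>\<^sub>m 1\<^sub>m d) (0\<^sub>m d m) R ?T) = det (c \<cdot>\<^sub>m 1\<^sub>m d :: complex mat) * det ?T"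
    by (rule det_four_block_mat_upper_right_zero[of _ d _ m]) (use Q R S in auto)
  moreover have "det ?U = det (1\<^sub>m d :: complex mat) * det (1\<^sub>m m :: complex mat)"
    by (rule det_four_block_mat_lower_left_zero[of _ d _ m]) (use Q in auto)
  ultimately show ?thesis using det_mult[OF M U] by (simp add: det_smult)
qed

text \<open>The function G of the introduction, with scalar z instead of a polynomial variable so
  that the tower recursion may divide by z - t.\<close>

definition pencil :: "complex mat \<Rightarrow> complex \<Rightarrow> complex \<Rightarrow> real \<Rightarrow> complex" where
  "pencil X z t \<theta> = det (z \<cdot>\<^sub>m 1\<^sub>m (dim_row X) - (Hmat X \<theta> + t \<cdot>\<^sub>m defect X))"

lemma poly_char_poly_eq_pencil:
  assumes X: "X \<in> carrier_mat n n"
  shows "poly (char_poly (Hmat X \<theta> + t \<cdot>\<^sub>m defect X)) z = pencil X z t \<theta>"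
proof -
  have H: "Hmat X \<theta> + t \<cdot>\<^sub>m defect X \<in> carrier_mat n n"
    using X defect_carrier[OF X] by auto
  show ?thesis
    unfolding char_poly_matrix[OF H] pencil_def char_matrix_def
    using X
    by (intro arg_cong[of _ _ det] eq_matI) auto
qed

text \<open>A polynomial is fixed by its values on an infinite set. Real z > 1 are used because
  there the recursion started at t = 0 stays away from its pole t = z.\<close>

lemma char_poly_eq_iff_pencil_eq:
  assumes X: "X \<in> carrier_mat n n"
  shows "char_poly (Hmat X \<theta> + t \<cdot>\<^sub>m defect X) = char_poly (Hmat X \<theta>' + t \<cdot>\<^sub>m defect X) \<longleftrightarrow>
    (\<forall>z>1. pencil X (of_real z) t \<theta> = pencil X (of_real z) t \<theta>')"
proof
  have inf: "infinite (complex_of_real ` {1<..})"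
    using infinite_Ioi[of "1::real"] by (auto dest!: finite_imageD simp: inj_on_def)
  assume "\<forall>z>1. pencil X (of_real z) t \<theta> = pencil X (of_real z) t \<theta>'"
  then show "char_poly (Hmat X \<theta> + t \<cdot>\<^sub>m defect X) = char_poly (Hmat X \<theta>' + t \<cdot>\<^sub>m defect X)"
    by (intro poly_eq_on_infinite[OF inf]) (auto simp: poly_char_poly_eq_pencil[OF X])
qed (simp flip: poly_char_poly_eq_pencil[OF X])

text \<open>The determinant is taken over matrices whose entries are polynomials of degree at most 1
  in t, and then evaluated.\<close>

lemma pencil_is_poly_in_t:
  assumes X: "X \<in> carrier_mat n n"
  shows "\<exists>p. \<forall>t. poly p t = pencil X z t \<theta>"
proof -
  let ?M = "mat n n (\<lambda>(i,j). [: (z \<cdot>\<^sub>m 1\<^sub>m n - Hmat X \<theta>) $$ (i,j), - defect X $$ (i,j) :])"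
  have "poly (det ?M) t = pencil X z t \<theta>" for t
    unfolding pencil_def using X
    by (intro poly_det_cong[of _ n]) (auto simp: algebra_simps)
  then show ?thesis by blast
qed

context
  fixes X :: "complex mat" and m :: nat
  assumes X: "X \<in> carrier_mat m m" and contr: "contraction X"
begin

private abbreviation "d \<equiv> defect_rank X"
private abbreviation "B \<equiv> Bmat X"

private lemma B: "B \<in> carrier_mat d m" and BB: "mat_adjoint B * B = defect X"
  using Bmat_properties[OF X contr] by auto

lemma Amap_carrier: "Amap X \<in> carrier_mat (d + m) (d + m)"
  unfolding Amap_def using X by auto

text \<open>The lower right block of the Gram matrix is defect plus adjoint times \<open>X\<close>,
  which is the identity; this is why each new level is a partial isometry.\<close>

lemma defect_Amap:
  "defect (Amap X) = four_block_mat (1\<^sub>m d) (0\<^sub>m d m) (0\<^sub>m m d) (0\<^sub>m m m)"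
proof -
  have "mat_adjoint (Amap X) * Amap X = four_block_mat (mat_adjoint (0\<^sub>m d d)) (mat_adjoint (0\<^sub>m m d))
      (mat_adjoint B) (mat_adjoint X) * four_block_mat (0\<^sub>m d d) B (0\<^sub>m m d) X"
    unfolding Amap_def using X B by (subst adjoint_four_block_mat[of _ d d _ m _ m]) auto
  also have "\<dots> = four_block_mat (mat_adjoint (0\<^sub>m d d) * 0\<^sub>m d d + mat_adjoint (0\<^sub>m m d) * 0\<^sub>m m d)
      (mat_adjoint (0\<^sub>m d d) * B + mat_adjoint (0\<^sub>m m d) * X)
      (mat_adjoint B * 0\<^sub>m d d + mat_adjoint X * 0\<^sub>m m d) (mat_adjoint B * B + mat_adjoint X * X)"
    by (rule mult_four_block_mat) (use X B in auto)
  also have "mat_adjoint (0\<^sub>m d d) * 0\<^sub>m d d + mat_adjoint (0\<^sub>m m d) * 0\<^sub>m m d = (0\<^sub>m d d :: complex mat)"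
    by (intro eq_matI) (auto simp: scalar_prod_def)
  also have "mat_adjoint (0\<^sub>m d d) * B + mat_adjoint (0\<^sub>m m d) * X = 0\<^sub>m d m"
    using X B by (intro eq_matI) (auto simp: scalar_prod_def)
  also have "mat_adjoint B * 0\<^sub>m d d + mat_adjoint X * 0\<^sub>m m d = 0\<^sub>m m d"
    using X B by (intro eq_matI) (auto simp: scalar_prod_def)
  also have "mat_adjoint B * B + mat_adjoint X * X = 1\<^sub>m m"
    unfolding BB defect_def using X by (intro eq_matI) auto
  finally have AA: "mat_adjoint (Amap X) * Amap X =
      four_block_mat (0\<^sub>m d d) (0\<^sub>m d m) (0\<^sub>m m d) (1\<^sub>m m)" .
  show ?thesis
    unfolding defect_def AA using Amap_carrier by (intro eq_matI) auto
qed

text \<open>The loss of squared norm is the squared norm of the first \<open>d\<close> coordinates,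
  hence nonnegative.\<close>

lemma contraction_Amap: "contraction (Amap X)"
  unfolding contraction_def
proof
  let ?n = "d + m"
  fix v :: "complex vec" assume "v \<in> carrier_vec (dim_col (Amap X))"
  then have v: "v = vec ?n (($) v)" using Amap_carrier by auto
  have "sesq ?n (\<lambda>i j. defect (Amap X) $$ (i,j)) (($) v) (($) v) =
      (\<Sum>i<?n. \<Sum>j<?n. of_bool (i < d) * (cnj (v $ i) * v $ j) * of_bool (j = i))"
    unfolding sesq_def defect_Amap by (intro sum.cong refl) auto
  also have "\<dots> = (\<Sum>i<?n. of_bool (i < d) * (cnj (v $ i) * v $ i))"
    by (intro sum.cong refl sum_of_bool_eq) simp
  also have "\<dots> = of_real (\<Sum>i<?n. of_bool (i < d) * (cmod (v $ i))\<^sup>2)"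
    unfolding of_real_sum of_real_mult complex_norm_square
    by (intro sum.cong refl) (auto simp: of_bool_def)
  finally have "complex_of_real (vnorm2 v - vnorm2 (Amap X *\<^sub>v v)) =
      of_real (\<Sum>i<?n. of_bool (i < d) * (cmod (v $ i))\<^sup>2)"
    unfolding sesq_defect[OF Amap_carrier] v[symmetric] .
  then have "vnorm2 v - vnorm2 (Amap X *\<^sub>v v) = (\<Sum>i<?n. of_bool (i < d) * (cmod (v $ i))\<^sup>2)"
    by (simp only: of_real_eq_iff)
  moreover have "0 \<le> (\<Sum>i<?n. of_bool (i < d) * (cmod (v $ i))\<^sup>2)"
    by (intro sum_nonneg) auto
  ultimately show "vnorm2 (Amap X *\<^sub>v v) \<le> vnorm2 v" by linarith
qed

text \<open>The off-diagonal blocks carry opposite phases, which cancel in the Schur complement and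
  leave a quarter of the defect. Thus \<theta> enters only through
  \<open>Hmat X \<theta>\<close>.\<close>

lemma pencil_Amap:
  assumes "z \<noteq> t"
  shows "pencil (Amap X) z t \<theta> = (z - t) ^ d * pencil X z (1 / (4 * (z - t))) \<theta>"
proof -
  define a b where "a = cis (- \<theta>) / 2" and "b = cis \<theta> / 2"
  have ab: "b * a = 1 / 4" by (simp add: a_def b_def cis_mult)
  let ?S = "z \<cdot>\<^sub>m 1\<^sub>m m - Hmat X \<theta>"
  have H: "Hmat X \<theta> \<in> carrier_mat m m" and D: "defect X \<in> carrier_mat m m" using X by auto
  have adj: "mat_adjoint (Amap X) = four_block_mat (mat_adjoint (0\<^sub>m d d)) (mat_adjoint (0\<^sub>m m d))
      (mat_adjoint B) (mat_adjoint X)"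
    unfolding Amap_def using X B by (subst adjoint_four_block_mat[of _ d d _ m _ m]) auto
  have "z \<cdot>\<^sub>m 1\<^sub>m (dim_row (Amap X)) - (Hmat (Amap X) \<theta> + t \<cdot>\<^sub>m defect (Amap X)) =
      four_block_mat ((z - t) \<cdot>\<^sub>m 1\<^sub>m d) ((- a) \<cdot>\<^sub>m B) ((- b) \<cdot>\<^sub>m mat_adjoint B) ?S"
    unfolding Hmat_eq_cis[OF Amap_carrier] Hmat_eq_cis[OF X] a_def[symmetric] b_def[symmetric]
      adj defect_Amap unfolding Amap_def
    using X B by (intro eq_matI) (auto simp: algebra_simps)
  then have "pencil (Amap X) z t \<theta> = det (four_block_mat ((z - t) \<cdot>\<^sub>m 1\<^sub>m d) ((- a) \<cdot>\<^sub>m B)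
      ((- b) \<cdot>\<^sub>m mat_adjoint B) ?S)"
    unfolding pencil_def by simp
  also have "\<dots> = (z - t) ^ d * det (?S - (1 / (z - t)) \<cdot>\<^sub>m ((- b) \<cdot>\<^sub>m mat_adjoint B * ((- a) \<cdot>\<^sub>m B)))"
    using assms X B H by (intro det_four_block_scalar_upper_left[of _ _ _ m]) auto
  also have "(- b) \<cdot>\<^sub>m mat_adjoint B * ((- a) \<cdot>\<^sub>m B) = (1 / 4) \<cdot>\<^sub>m defect X"
  proof -
    have "(- b) \<cdot>\<^sub>m mat_adjoint B * ((- a) \<cdot>\<^sub>m B) = (- b) \<cdot>\<^sub>m (mat_adjoint B * ((- a) \<cdot>\<^sub>m B))"
      using B by (intro mult_smult_assoc_mat[of _ m d _ m]) auto
    also have "mat_adjoint B * ((- a) \<cdot>\<^sub>m B) = (- a) \<cdot>\<^sub>m defect X"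
      unfolding BB[symmetric] using B by (intro mult_smult_distrib[of _ m d _ m]) auto
    finally show ?thesis using X by (intro eq_matI) (auto simp: mult.assoc[symmetric] ab)
  qed
  also have "?S - (1 / (z - t)) \<cdot>\<^sub>m ((1 / 4) \<cdot>\<^sub>m defect X) =
      z \<cdot>\<^sub>m 1\<^sub>m (dim_row X) - (Hmat X \<theta> + (1 / (4 * (z - t))) \<cdot>\<^sub>m defect X)"
    using X H D by (intro eq_matI) (auto simp: algebra_simps)
  finally show ?thesis unfolding pencil_def .
qed

end

section \<open>Iterating the recursion: the orbit of a Moebius map\<close>

lemma tower_carrier_contraction:
  assumes "C \<in> carrier_mat n n" "contraction C"
  shows "\<exists>N. tower C j \<in> carrier_mat N N \<and> contraction (tower C j)"
proof (induction j)
  case 0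
  then show ?case using assms by auto
next
  case (Suc j)
  then obtain N where "tower C j \<in> carrier_mat N N" "contraction (tower C j)" by blast
  from Amap_carrier[OF this] contraction_Amap[OF this] show ?case by auto
qed

definition phi :: "real \<Rightarrow> real \<Rightarrow> real" where
  "phi z t = 1 / (4 * (z - t))"

text \<open>Here z - t > 1/2, so the interval from 0 to 1/2 is mapped into itself.\<close>

lemma phi_bounds:
  assumes "1 < z" "0 \<le> t" "t \<le> 1/2"
  shows "0 < phi z t" "phi z t \<le> 1/2"
  using assms by (auto simp: phi_def field_simps)

text \<open>With t arbitrary, the induction can remove the top level: level j + 1 at t becomes level
  j at \<open>phi z t\<close>. Since \<open>K\<close> is nonzero and does not depend on \<theta>,
  angles can be compared at \<open>C\<close> instead.\<close>

lemma pencil_tower: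
  assumes C: "C \<in> carrier_mat n n" "contraction C" and z: "1 < z" and t: "0 \<le> t" "t \<le> 1/2"
  shows "\<exists>K. K \<noteq> 0 \<and> (\<forall>\<theta>. pencil (tower C j) (of_real z) (of_real t) \<theta> =
    K * pencil C (of_real z) (of_real ((phi z ^^ j) t)) \<theta>)"
  using t
proof (induction j arbitrary: t)
  case 0
  then show ?case by (intro exI[of _ 1]) auto
next
  case (Suc j)
  obtain N where N: "tower C j \<in> carrier_mat N N" "contraction (tower C j)"
    using tower_carrier_contraction[OF C] by blast
  have "z \<noteq> t" using z Suc.prems(2) by simp
  then have zt: "complex_of_real z \<noteq> of_real t" by (simp only: of_real_eq_iff not_False_eq_True)
  have phi: "1 / (4 * (complex_of_real z - of_real t)) = of_real (phi z t)"
    by (simp add: phi_def)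
  have b: "0 \<le> phi z t" "phi z t \<le> 1/2" using phi_bounds[OF z Suc.prems] by simp_all
  obtain K where "K \<noteq> 0" and K: "\<forall>\<theta>. pencil (tower C j) (of_real z) (of_real (phi z t)) \<theta> =
      K * pencil C (of_real z) (of_real ((phi z ^^ j) (phi z t))) \<theta>"
    using Suc.IH[OF b] by blast
  have "pencil (tower C (Suc j)) (of_real z) (of_real t) \<theta> =
      ((of_real z - of_real t) ^ defect_rank (tower C j) * K) *
        pencil C (of_real z) (of_real ((phi z ^^ Suc j) t)) \<theta>" for \<theta>
    using pencil_Amap[OF N zt, of \<theta>] unfolding phi K[rule_format] by (simp add: funpow_swap1)
  moreover have "(of_real z - of_real t) ^ defect_rank (tower C j) * K \<noteq> 0"
    using zt \<open>K \<noteq> 0\<close> by simp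
  ultimately show ?case by blast
qed

text \<open>\<open>phi z\<close> is increasing below its pole and positive at 0, so the orbit of 0
  increases strictly.\<close>

lemma infinite_phi_orbit:
  assumes z: "1 < z"
  shows "infinite (range (\<lambda>j. (phi z ^^ j) 0))"
proof -
  have "0 \<le> (phi z ^^ j) 0 \<and> (phi z ^^ j) 0 < (phi z ^^ Suc j) 0 \<and> (phi z ^^ Suc j) 0 \<le> 1/2" for j
  proof (induction j)
    case 0
    then show ?case using phi_bounds[OF z, of 0] by simp
  next
    case (Suc j)
    define x y where "x = (phi z ^^ j) 0" and "y = (phi z ^^ Suc j) 0"
    have xy: "0 \<le> x" "x < y" "y \<le> 1/2" using Suc by (simp_all add: x_def y_def)
    have "phi z x < phi z y" using xy z by (simp add: phi_def divide_simps)
    moreover have "y = phi z x" by (simp add: x_def y_def)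
    moreover have "(phi z ^^ Suc (Suc j)) 0 = phi z y" by (simp add: y_def)
    ultimately show ?case using xy phi_bounds[OF z, of y] unfolding y_def[symmetric] by auto
  qed
  then have "strict_mono (\<lambda>j. (phi z ^^ j) 0)" unfolding strict_mono_Suc_iff by blast
  then show ?thesis by (intro range_inj_infinite strict_mono_imp_inj_on)
qed

section \<open>From spectra as sets to characteristic polynomials\<close>

lemma continuous_on_det:
  fixes M :: "'b :: topological_space \<Rightarrow> complex mat"
  assumes M: "\<And>x. M x \<in> carrier_mat n n"
    and cont: "\<And>i j. i < n \<Longrightarrow> j < n \<Longrightarrow> continuous_on S (\<lambda>x. M x $$ (i,j))"
  shows "continuous_on S (\<lambda>x. det (M x))"
  unfolding det_def'[OF M]
  by (intro continuous_intros cont) (auto dest: permutes_in_image)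

text \<open>Finite sets are closed in a T1 space, so a point and its complement in \<open>S\<close>
  would disconnect \<open>S\<close>.\<close>

lemma connected_finite_unique:
  fixes S :: "'b :: t1_space set"
  assumes "connected S" "finite S" "a \<in> S" "b \<in> S"
  shows "a = b"
proof (rule ccontr)
  assume "a \<noteq> b"
  moreover have "closed {a}" "closed (S - {a})"
    using assms(2) by (auto intro: finite_imp_closed)
  ultimately show False
    using assms unfolding connected_closed by blast
qed

text \<open>Equality of the spectra as sets already fixes the multiplicities: for each \<open>z\<close> the value at \<open>z\<close> of the
characteristic polynomial is continuous in the angle and takes only finitely many values.\<close>

lemma circularity_iff_char_poly_constant:
  assumes X: "X \<in> carrier_mat n n"
  shows "circularity X \<longleftrightarrow> (\<forall>\<theta>. char_poly (Hmat X \<theta>) = char_poly (Hmat X 0))"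
proof
  assume "\<forall>\<theta>. char_poly (Hmat X \<theta>) = char_poly (Hmat X 0)"
  then have "spectrum (Hmat X \<theta>) = spectrum (Hmat X 0)" for \<theta>
    using spectrum_root_char_poly[OF Hmat_carrier[OF X]] by metis
  then show "circularity X" unfolding circularity_def by metis
next
  assume circ: "circularity X"
  show "\<forall>\<theta>. char_poly (Hmat X \<theta>) = char_poly (Hmat X 0)"
  proof
    fix \<theta>0
    have "poly (char_poly (Hmat X \<theta>0)) z = poly (char_poly (Hmat X 0)) z" for z
    proof -
      let ?f = "\<lambda>\<theta>. poly (char_poly (Hmat X \<theta>)) z"
      let ?S = "spectrum (Hmat X 0)"
      \<comment> \<open>Each value is a product over n eigenvalues from one fixed finite spectrum,
        so only finitely many values are possible.\<close>
      have "?f \<theta> \<in> (\<lambda>as. \<Prod>a\<leftarrow>as. z - a) ` {as. set as \<subseteq> ?S \<and> length as = n}" for \<theta>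
      proof -
        obtain as where as: "char_poly (Hmat X \<theta>) = (\<Prod>a\<leftarrow>as. [:- a, 1:])" "length as = n"
          using char_poly_factorized[OF Hmat_carrier[OF X]] by blast
        have "set as \<subseteq> spectrum (Hmat X \<theta>)"
          unfolding spectrum_root_char_poly[OF Hmat_carrier[OF X]] as(1) poly_prod_list
          by (auto simp: prod_list_zero_iff)
        also have "spectrum (Hmat X \<theta>) = ?S" using circ unfolding circularity_def by blast
        finally show ?thesis using as by (auto simp: poly_prod_list o_def)
      qed
      then have "range ?f \<subseteq> (\<lambda>as. \<Prod>a\<leftarrow>as. z - a) ` {as. set as \<subseteq> ?S \<and> length as = n}" by blast
      then have "finite (range ?f)"
        by (rule finite_subset[OF _ finite_imageI[OF
            finite_lists_length_eq[OF card_finite_spectrum(1)[OF Hmat_carrier[OF X]]]]])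
      moreover have "continuous_on UNIV ?f"
        unfolding char_poly_matrix[OF Hmat_carrier[OF X]]
      proof (rule continuous_on_det[of _ n])
        fix i j assume ij: "i < n" "j < n"
        have "(- char_matrix (Hmat X \<theta>) z) $$ (i,j) =
            z * 1\<^sub>m n $$ (i,j) - (cis (- \<theta>) / 2 * X $$ (i,j) + cis \<theta> / 2 * mat_adjoint X $$ (i,j))" for \<theta>
          unfolding char_matrix_def Hmat_eq_cis[OF X] using ij X by auto
        then show "continuous_on UNIV (\<lambda>\<theta>. (- char_matrix (Hmat X \<theta>) z) $$ (i,j))"
          by (simp add: cis_conv_exp continuous_intros)
      qed (use X in auto)
      then have "connected (range ?f)"
        by (rule connected_continuous_image) simp
      ultimately show ?thesis using connected_finite_unique by blast
    qed
    then show "char_poly (Hmat X \<theta>0) = char_poly (Hmat X 0)" by (simp add: poly_eq_poly_eq_iff[symmetric] ext)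
  qed
qed

section \<open>Circularity of all levels in terms of the pencil of the base matrix\<close>

lemma circularity_iff_pencil_constant:
  assumes X: "X \<in> carrier_mat n n"
  shows "circularity X \<longleftrightarrow> (\<forall>z>1. \<forall>\<theta>. pencil X (of_real z) 0 \<theta> = pencil X (of_real z) 0 0)"
proof -
  have H: "Hmat X \<theta> + 0 \<cdot>\<^sub>m defect X = Hmat X \<theta>" for \<theta>
    using X by (intro eq_matI) auto
  show ?thesis
    unfolding circularity_iff_char_poly_constant[OF X]
      char_poly_eq_iff_pencil_eq[OF X, where t = 0, unfolded H] by blast
qed

lemma tower_circularity_iff_pencil_constant:
  assumes C: "C \<in> carrier_mat n n" "contraction C"
  shows "(\<forall>j. circularity (tower C j)) \<longleftrightarrow> (\<forall>z>1. \<forall>t \<theta>. pencil C (of_real z) t \<theta> = pencil C (of_real z) t 0)"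
proof -
  \<comment> \<open>Level j sees the pencil of \<open>C\<close> only at the j-th orbit point of 0,
    for every z > 1.\<close>
  have level: "circularity (tower C j) \<longleftrightarrow> (\<forall>z>1. \<forall>\<theta>.
      pencil C (of_real z) (of_real ((phi z ^^ j) 0)) \<theta> = pencil C (of_real z) (of_real ((phi z ^^ j) 0)) 0)" for j
  proof -
    obtain N where N: "tower C j \<in> carrier_mat N N"
      using tower_carrier_contraction[OF C] by blast
    have "pencil (tower C j) (of_real z) 0 \<theta> = pencil (tower C j) (of_real z) 0 0 \<longleftrightarrow>
        pencil C (of_real z) (of_real ((phi z ^^ j) 0)) \<theta> = pencil C (of_real z) (of_real ((phi z ^^ j) 0)) 0"
      if z: "1 < z" for z \<theta>
    proof -
      obtain K where "K \<noteq> 0" "\<forall>\<theta>. pencil (tower C j) (of_real z) (of_real 0) \<theta> =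
          K * pencil C (of_real z) (of_real ((phi z ^^ j) 0)) \<theta>"
        using pencil_tower[OF C z, of 0 j] by auto
      then show ?thesis by simp
    qed
    then show ?thesis unfolding circularity_iff_pencil_constant[OF N] by blast
  qed
  show ?thesis
  proof (intro iffI allI impI)
    fix z :: real and t \<theta>
    assume circ: "\<forall>j. circularity (tower C j)" and z: "1 < z"
    obtain p q where p: "\<forall>t. poly p t = pencil C (of_real z) t \<theta>" and q: "\<forall>t. poly q t = pencil C (of_real z) t 0"
      using pencil_is_poly_in_t[OF C(1)] by metis
    \<comment> \<open>For fixed z and \<theta>, the levels give infinitely many points at which the
      two polynomials in t agree.\<close>
    have "infinite (complex_of_real ` range (\<lambda>j. (phi z ^^ j) 0))"
      using infinite_phi_orbit[OF z] by (auto dest!: finite_imageD simp: inj_on_def)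
    moreover have "poly p x = poly q x" if x: "x \<in> complex_of_real ` range (\<lambda>j. (phi z ^^ j) 0)" for x
    proof -
      obtain j where j: "x = of_real ((phi z ^^ j) 0)" using x by blast
      have "circularity (tower C j)" using circ by blast
      then show ?thesis unfolding p[rule_format] q[rule_format] j level using z by blast
    qed
    ultimately have "p = q" by (rule poly_eq_on_infinite)
    then show "pencil C (of_real z) t \<theta> = pencil C (of_real z) t 0"
      using p q by metis
  next
    fix j
    assume "\<forall>z>1. \<forall>t \<theta>. pencil C (of_real z) t \<theta> = pencil C (of_real z) t 0"
    then show "circularity (tower C j)" unfolding level by blast
  qed
qed

theorem mainTheorem6:
  fixes C :: "complex mat" and n :: nat
  assumes "C \<in> carrier_mat n n" and "contraction C"
  shows "(\<forall>j. circularity (tower C j)) \<longleftrightarrow>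
         (\<forall>k m l. 1 \<le> k \<and> k \<le> n \<and> m \<le> k \<and> l \<le> k - m \<and> 2 * l \<noteq> k - m
                  \<longrightarrow> Omega k m l C = 0)"
proof -
  note C = assms(1)
  let ?M = "\<lambda>t \<theta>. Hmat C \<theta> + t \<cdot>\<^sub>m defect C"
  have M: "?M t \<theta> \<in> carrier_mat n n" for t \<theta> using C by auto
  have "(\<forall>j. circularity (tower C j)) \<longleftrightarrow> (\<forall>t \<theta>. char_poly (?M t \<theta>) = char_poly (?M t 0))"
    unfolding tower_circularity_iff_pencil_constant[OF assms] char_poly_eq_iff_pencil_eq[OF C] by blast
  \<comment> \<open>The exponent k is moved outside t and \<theta>, since the passage to
    \<open>Omega\<close> treats one k at a time.\<close>
  also have "\<dots> \<longleftrightarrow> (\<forall>k. 1 \<le> k \<and> k \<le> n \<longrightarrow> (\<forall>t \<theta>. mtrace (?M t \<theta> ^\<^sub>m k) = mtrace (?M t 0 ^\<^sub>m k)))"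
    unfolding char_poly_eq_iff_mtrace_pow_eq[OF M M] by blast
  also have "\<dots> \<longleftrightarrow> (\<forall>k m l. 1 \<le> k \<and> k \<le> n \<and> m \<le> k \<and> l \<le> k - m \<and> 2 * l \<noteq> k - m
      \<longrightarrow> Omega k m l C = 0)"
    unfolding mtrace_pow_rotation_invariant_iff_Omega[OF C] by blast
  finally show ?thesis .
qed

end
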